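(* Let $(E,+,\cdot)$ be a commutative entire semiring. Let $S=E\oplus E$ be the semiring of pairs of elements of $E$ with pointwise addition and multiplication. Define $\sigma:S\to S$ by $\sigma(s,t)=(t,s)$. Then the following statements hold: (1) The semiring $S$ is nilpotent-free and $\sigma$ is an endomorphism on $S$. (2) The $\sigma$-expectation semiring $(S\widetilde{\oplus}S)_\sigma$ is eversible. (3) If $1+1\neq 0$ in $E$, then $(S\widetilde{\oplus}S)_\sigma$ is not reversible.
   Context: A semiring is an algebraic structure $(S,+,\cdot,0,1)$ such that $(S,+,0)$ is a commutative monoid, $(S,\cdot,1)$ is a monoid with $1\neq 0$, multiplication distributes over addition on both sides, and $a\cdot 0=0\cdot a=0$ for all $a\in S$. It is commutative if its multiplication is commutative, entire if $ab=0$ implies $a=0$ or $b=0$, nilpotent-free if $s^2=0$ implies $s=0$, and reversible if $st=0$ implies $ts=0$ for all its elements $s,t$. An element $s$ is a left (resp. right) zero-divisor if there is a nonzero $x$ with $sx=0$ (resp. $xs=0$); a semiring is eversible if its set of left zero-divisors equals its set of right zero-divisors. An endomorphism on $S$ is a semiring homomorphism $S\to S$. For a commutative semiring $S$, an $S$-semimodule $M$ and an endomorphism $\sigma$ on $S$, the $\sigma$-expectation semiring $(S\widetilde{\oplus}M)_\sigma$ is the set $S\times M$ with componentwise addition and multiplication $(s_1,m_1)\cdot(s_2,m_2)=(s_1s_2,\,\sigma(s_1)m_2+m_1s_2)$, where $ms:=sm$. Here $M=S$ as a semimodule over itself. *)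

theory Defs
  imports "HOL-Algebra.Chinese_Remainder" "HOL-Algebra.Module"
begin

text \<open>The library locale \<^locale>\<open>semiring\<close> allows the zero semiring, and neither the library
  homomorphisms \<^const>\<open>ring_hom\<close> nor its locale \<^locale>\<open>module\<close> is meant for structures without
  subtraction: preservation of zero and the two annihilation laws have to be required separately.\<close>

locale nontrivial_semiring = semiring +
  assumes one_not_zero: "\<one> \<noteq> \<zero>"

locale commutative_semiring = nontrivial_semiring + comm_monoid R

definition entire :: "('a, 'm) ring_scheme \<Rightarrow> bool" where
  "entire R \<longleftrightarrow> (\<forall>a\<in>carrier R. \<forall>b\<in>carrier R.
     a \<otimes>\<^bsub>R\<^esub> b = \<zero>\<^bsub>R\<^esub> \<longrightarrow> a = \<zero>\<^bsub>R\<^esub> \<or> b = \<zero>\<^bsub>R\<^esub>)"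

definition nilpotent_free :: "('a, 'm) ring_scheme \<Rightarrow> bool" where
  "nilpotent_free R \<longleftrightarrow>
     (\<forall>s\<in>carrier R. s [^]\<^bsub>R\<^esub> (2::nat) = \<zero>\<^bsub>R\<^esub> \<longrightarrow> s = \<zero>\<^bsub>R\<^esub>)"

definition reversible :: "('a, 'm) ring_scheme \<Rightarrow> bool" where
  "reversible R \<longleftrightarrow> (\<forall>s\<in>carrier R. \<forall>t\<in>carrier R.
     s \<otimes>\<^bsub>R\<^esub> t = \<zero>\<^bsub>R\<^esub> \<longrightarrow> t \<otimes>\<^bsub>R\<^esub> s = \<zero>\<^bsub>R\<^esub>)"

definition left_zero_divisors :: "('a, 'm) ring_scheme \<Rightarrow> 'a set" where
  "left_zero_divisors R =
     {s \<in> carrier R. \<exists>x\<in>carrier R. x \<noteq> \<zero>\<^bsub>R\<^esub> \<and> s \<otimes>\<^bsub>R\<^esub> x = \<zero>\<^bsub>R\<^esub>}"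

definition right_zero_divisors :: "('a, 'm) ring_scheme \<Rightarrow> 'a set" where
  "right_zero_divisors R =
     {s \<in> carrier R. \<exists>x\<in>carrier R. x \<noteq> \<zero>\<^bsub>R\<^esub> \<and> x \<otimes>\<^bsub>R\<^esub> s = \<zero>\<^bsub>R\<^esub>}"

definition eversible :: "('a, 'm) ring_scheme \<Rightarrow> bool" where
  "eversible R \<longleftrightarrow> left_zero_divisors R = right_zero_divisors R"

definition semiring_end :: "('a, 'm) ring_scheme \<Rightarrow> ('a \<Rightarrow> 'a) set" where
  "semiring_end R = {h \<in> ring_hom R R. h \<zero>\<^bsub>R\<^esub> = \<zero>\<^bsub>R\<^esub>}"

locale semimodule = R?: commutative_semiring R + M?: abelian_monoid M
  for R :: "('a, 'm) ring_scheme" (structure) and M :: "('a, 'b, 'n) module_scheme" (structure) +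
  assumes smult_closed:
      "\<lbrakk>a \<in> carrier R; x \<in> carrier M\<rbrakk> \<Longrightarrow> a \<odot>\<^bsub>M\<^esub> x \<in> carrier M"
    and smult_l_distr:
      "\<lbrakk>a \<in> carrier R; b \<in> carrier R; x \<in> carrier M\<rbrakk> \<Longrightarrow>
       (a \<oplus>\<^bsub>R\<^esub> b) \<odot>\<^bsub>M\<^esub> x = a \<odot>\<^bsub>M\<^esub> x \<oplus>\<^bsub>M\<^esub> b \<odot>\<^bsub>M\<^esub> x"
    and smult_r_distr:
      "\<lbrakk>a \<in> carrier R; x \<in> carrier M; y \<in> carrier M\<rbrakk> \<Longrightarrow>
       a \<odot>\<^bsub>M\<^esub> (x \<oplus>\<^bsub>M\<^esub> y) = a \<odot>\<^bsub>M\<^esub> x \<oplus>\<^bsub>M\<^esub> a \<odot>\<^bsub>M\<^esub> y"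
    and smult_assoc:
      "\<lbrakk>a \<in> carrier R; b \<in> carrier R; x \<in> carrier M\<rbrakk> \<Longrightarrow>
       (a \<otimes>\<^bsub>R\<^esub> b) \<odot>\<^bsub>M\<^esub> x = a \<odot>\<^bsub>M\<^esub> (b \<odot>\<^bsub>M\<^esub> x)"
    and smult_one: "x \<in> carrier M \<Longrightarrow> \<one>\<^bsub>R\<^esub> \<odot>\<^bsub>M\<^esub> x = x"
    and smult_l_null: "x \<in> carrier M \<Longrightarrow> \<zero>\<^bsub>R\<^esub> \<odot>\<^bsub>M\<^esub> x = \<zero>\<^bsub>M\<^esub>"
    and smult_r_null: "a \<in> carrier R \<Longrightarrow> a \<odot>\<^bsub>M\<^esub> \<zero>\<^bsub>M\<^esub> = \<zero>\<^bsub>M\<^esub>"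

text \<open>As for library modules, the multiplicative fields of the second record play no role.\<close>

definition self_semimodule :: "('a, 'm) ring_scheme \<Rightarrow> ('a, 'a) module" where
  "self_semimodule R =
     \<lparr> carrier = carrier R, mult = mult R, one = one R, zero = zero R, add = add R,
       smult = mult R \<rparr>"

text \<open>The right action of the formula \<open>\<sigma>(s\<^sub>1) m\<^sub>2 + m\<^sub>1 s\<^sub>2\<close> is the left action
  with the arguments exchanged.\<close>

definition expectation_semiring ::
  "('a, 'm) ring_scheme \<Rightarrow> ('a, 'b, 'n) module_scheme \<Rightarrow> ('a \<Rightarrow> 'a) \<Rightarrow> ('a \<times> 'b) ring" where
  "expectation_semiring S M \<sigma> =
     \<lparr> carrier = carrier S \<times> carrier M,
       mult = (\<lambda>(s\<^sub>1, m\<^sub>1) (s\<^sub>2, m\<^sub>2).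
         (s\<^sub>1 \<otimes>\<^bsub>S\<^esub> s\<^sub>2, (\<sigma> s\<^sub>1 \<odot>\<^bsub>M\<^esub> m\<^sub>2) \<oplus>\<^bsub>M\<^esub> (s\<^sub>2 \<odot>\<^bsub>M\<^esub> m\<^sub>1))),
       one = (\<one>\<^bsub>S\<^esub>, \<zero>\<^bsub>M\<^esub>),
       zero = (\<zero>\<^bsub>S\<^esub>, \<zero>\<^bsub>M\<^esub>),
       add = (\<lambda>(s\<^sub>1, m\<^sub>1) (s\<^sub>2, m\<^sub>2). (s\<^sub>1 \<oplus>\<^bsub>S\<^esub> s\<^sub>2, m\<^sub>1 \<oplus>\<^bsub>M\<^esub> m\<^sub>2)) \<rparr>"

lemma (in commutative_semiring) semimodule_self: "semimodule R (self_semimodule R)"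
proof -
  have "abelian_monoid (self_semimodule R)"
    by (rule abelian_monoidI) (auto simp: self_semimodule_def a_ac)
  then show ?thesis
    by (intro semimodule.intro commutative_semiring_axioms semimodule_axioms.intro)
      (auto simp: self_semimodule_def l_distr r_distr m_assoc)
qed

lemma commutative_semiring_RDirProd:
  assumes "commutative_semiring R" and "commutative_semiring S"
  shows "commutative_semiring (RDirProd R S)"
proof -
  interpret R: commutative_semiring R by fact
  interpret S: commutative_semiring S by fact
  show ?thesis
    by (unfold_locales)
      (auto simp: RDirProd_def DirProd_def monoid.defs R.one_not_zero Units_def
        R.a_ac S.a_ac R.m_ac S.m_ac R.l_distr R.r_distr S.l_distr S.r_distr)
qed

lemma (in semimodule) nontrivial_semiring_expectation:
  assumes "\<sigma> \<in> semiring_end R"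
  shows "nontrivial_semiring (expectation_semiring R M \<sigma>)"
proof -
  have s: "\<sigma> a \<in> carrier R" "\<sigma> (a \<otimes> b) = \<sigma> a \<otimes> \<sigma> b" "\<sigma> (a \<oplus> b) = \<sigma> a \<oplus> \<sigma> b"
    "\<sigma> \<one> = \<one>" "\<sigma> \<zero> = \<zero>" if "a \<in> carrier R" "b \<in> carrier R" for a b
    using that assms by (auto simp: semiring_end_def ring_hom_def)
  have comm: "a \<odot>\<^bsub>M\<^esub> (b \<odot>\<^bsub>M\<^esub> x) = b \<odot>\<^bsub>M\<^esub> (a \<odot>\<^bsub>M\<^esub> x)"
    if "a \<in> carrier R" "b \<in> carrier R" "x \<in> carrier M" for a b x
    using that by (metis smult_assoc R.m_comm)
  show ?thesis
    by (unfold_locales)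
      (auto simp: expectation_semiring_def s comm smult_closed smult_l_distr smult_r_distr
        smult_assoc smult_one smult_l_null smult_r_null R.one_not_zero
        R.a_ac M.a_ac R.m_assoc R.l_distr R.r_distr Units_def)
qed

end

theory Submission
  imports Defs
begin

text \<open>The product of \<open>((a, b), (c, d))\<close> and \<open>((x, y), (z, w))\<close> in the expectation semiring is
  \<open>((a x, b y), (b z + x c, a w + y d))\<close>. If \<open>a\<close> and \<open>b\<close> are nonzero, then \<open>((a, b), (c, d))\<close> can
  be cancelled from both sides because the base is entire; if one of them is zero, then
  \<open>((0, 0), (1, 0))\<close> or \<open>((0, 0), (0, 1))\<close> annihilates it from either side. So the left and the
  right zero-divisors are the same elements, namely those with \<open>a = 0\<close> or \<open>b = 0\<close>. Reversibility
  fails because \<open>((1, 0), (0, 0)) ((0, 0), (1, 0)) = 0\<close>, while the product in the other order is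
  \<open>((0, 0), (1, 0))\<close>.\<close>

text \<open>Being an abbreviation, it matches the term of the theorem as soon as the equations for
  \<open>S\<close> and \<open>\<sigma>\<close> are unfolded.\<close>

abbreviation swap_expectation :: "('a, 'm) ring_scheme \<Rightarrow> (('a \<times> 'a) \<times> ('a \<times> 'a)) ring" where
  "swap_expectation E \<equiv>
     expectation_semiring (RDirProd E E) (self_semimodule (RDirProd E E)) (\<lambda>(s, t). (t, s))"

lemma RDirProd_simps:
  "carrier (RDirProd R S) = carrier R \<times> carrier S"
  "(a, b) \<otimes>\<^bsub>RDirProd R S\<^esub> (c, d) = (a \<otimes>\<^bsub>R\<^esub> c, b \<otimes>\<^bsub>S\<^esub> d)"
  "(a, b) \<oplus>\<^bsub>RDirProd R S\<^esub> (c, d) = (a \<oplus>\<^bsub>R\<^esub> c, b \<oplus>\<^bsub>S\<^esub> d)"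
  "\<one>\<^bsub>RDirProd R S\<^esub> = (\<one>\<^bsub>R\<^esub>, \<one>\<^bsub>S\<^esub>)"
  "\<zero>\<^bsub>RDirProd R S\<^esub> = (\<zero>\<^bsub>R\<^esub>, \<zero>\<^bsub>S\<^esub>)"
  by (auto simp: RDirProd_def DirProd_def monoid.defs)

text \<open>Only the left factor passes through \<open>\<sigma>\<close>: \<open>z\<close> and
  \<open>w\<close> meet \<open>b\<close> and \<open>a\<close> crosswise, while \<open>c\<close> and
  \<open>d\<close> meet \<open>x\<close> and \<open>y\<close> straight.\<close>

lemma swap_expectation_simps:
  "carrier (swap_expectation E) =
     (carrier E \<times> carrier E) \<times> (carrier E \<times> carrier E)"
  "\<zero>\<^bsub>swap_expectation E\<^esub> = ((\<zero>\<^bsub>E\<^esub>, \<zero>\<^bsub>E\<^esub>), (\<zero>\<^bsub>E\<^esub>, \<zero>\<^bsub>E\<^esub>))"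
  "((a, b), (c, d)) \<otimes>\<^bsub>swap_expectation E\<^esub> ((x, y), (z, w)) =
     ((a \<otimes>\<^bsub>E\<^esub> x, b \<otimes>\<^bsub>E\<^esub> y),
      (b \<otimes>\<^bsub>E\<^esub> z \<oplus>\<^bsub>E\<^esub> x \<otimes>\<^bsub>E\<^esub> c, a \<otimes>\<^bsub>E\<^esub> w \<oplus>\<^bsub>E\<^esub> y \<otimes>\<^bsub>E\<^esub> d))"
  by (simp_all add: expectation_semiring_def self_semimodule_def RDirProd_simps)

lemma entire_mult_eq_zero_iff:
  assumes "semiring E" "entire E" "a \<in> carrier E" "b \<in> carrier E"
  shows "a \<otimes>\<^bsub>E\<^esub> b = \<zero>\<^bsub>E\<^esub> \<longleftrightarrow> a = \<zero>\<^bsub>E\<^esub> \<or> b = \<zero>\<^bsub>E\<^esub>"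
proof -
  interpret semiring E by fact
  show ?thesis using assms(2-) by (auto simp: entire_def)
qed

text \<open>Squares are taken componentwise, and in an entire factor only zero squares to
  zero.\<close>

lemma nilpotent_free_RDirProd:
  assumes "semiring R" "entire R" "semiring S" "entire S"
  shows "nilpotent_free (RDirProd R S)"
proof -
  interpret R: semiring R by fact
  interpret S: semiring S by fact
  show ?thesis
    using assms(2,4)
    by (auto simp: nilpotent_free_def entire_def numeral_2_eq_2 RDirProd_simps)
qed

lemma swap_semiring_end: "(\<lambda>(s, t). (t, s)) \<in> semiring_end (RDirProd R R)"
  by (auto simp: semiring_end_def ring_hom_def RDirProd_simps)

context
  fixes E :: "('a, 'm) ring_scheme" (structure)
  assumes E: "nontrivial_semiring E" and ent: "entire E"
begin

interpretation nontrivial_semiring E by (fact E)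

lemmas zero_iff = entire_mult_eq_zero_iff[OF semiring_axioms ent]

lemma left_zero_divisors_swap_expectation:
  "left_zero_divisors (swap_expectation E) =
     {((a, b), m) | a b m. a \<in> carrier E \<and> b \<in> carrier E \<and> m \<in> carrier E \<times> carrier E \<and>
        (a = \<zero> \<or> b = \<zero>)}" (is "?L = ?Z")
proof
  show "?L \<subseteq> ?Z"
    \<comment> \<open>For nonzero \<open>a\<close> and \<open>b\<close>, the first component of the
      product forces \<open>x = y = 0\<close>. The second is then \<open>(b z, a w)\<close>, so
      \<open>z = w = 0\<close> as well.\<close>
    by (auto simp: left_zero_divisors_def swap_expectation_simps zero_iff)
  show "?Z \<subseteq> ?L"
  proof
    fix u assume "u \<in> ?Z"
    then obtain a b c d where u: "u = ((a, b), (c, d))"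
      and car: "a \<in> carrier E" "b \<in> carrier E" "c \<in> carrier E" "d \<in> carrier E"
      and ab: "a = \<zero> \<or> b = \<zero>"
      by auto
    \<comment> \<open>With first component zero in \<open>v\<close>, the product \<open>u v\<close>
      is \<open>((0, 0), (b z, a w))\<close>; the unit goes where its coefficient vanishes.\<close>
    define v where "v = ((\<zero>, \<zero>), if b = \<zero> then (\<one>, \<zero>) else (\<zero>, \<one>))"
    have "v \<in> carrier (swap_expectation E)" "v \<noteq> \<zero>\<^bsub>swap_expectation E\<^esub>"
      "u \<otimes>\<^bsub>swap_expectation E\<^esub> v = \<zero>\<^bsub>swap_expectation E\<^esub>"
      using car ab by (auto simp: u v_def swap_expectation_simps one_not_zero)
    moreover have "u \<in> carrier (swap_expectation E)"
      using car by (simp add: u swap_expectation_simps)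
    ultimately show "u \<in> ?L"
      unfolding left_zero_divisors_def by blast
  qed
qed

lemma right_zero_divisors_swap_expectation:
  "right_zero_divisors (swap_expectation E) =
     {((a, b), m) | a b m. a \<in> carrier E \<and> b \<in> carrier E \<and> m \<in> carrier E \<times> carrier E \<and>
        (a = \<zero> \<or> b = \<zero>)}" (is "?R = ?Z")
proof
  show "?R \<subseteq> ?Z"
    by (auto simp: right_zero_divisors_def swap_expectation_simps zero_iff)
  show "?Z \<subseteq> ?R"
  proof
    fix u assume "u \<in> ?Z"
    then obtain a b c d where u: "u = ((a, b), (c, d))"
      and car: "a \<in> carrier E" "b \<in> carrier E" "c \<in> carrier E" "d \<in> carrier E"
      and ab: "a = \<zero> \<or> b = \<zero>"
      by auto
    \<comment> \<open>Here \<open>\<sigma>\<close> hits the zero component of \<open>v\<close>, so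
      \<open>v u\<close> is \<open>((0, 0), (a z, b w))\<close> without a swap; hence the case split
      is on \<open>a\<close>.\<close>
    define v where "v = ((\<zero>, \<zero>), if a = \<zero> then (\<one>, \<zero>) else (\<zero>, \<one>))"
    have "v \<in> carrier (swap_expectation E)" "v \<noteq> \<zero>\<^bsub>swap_expectation E\<^esub>"
      "v \<otimes>\<^bsub>swap_expectation E\<^esub> u = \<zero>\<^bsub>swap_expectation E\<^esub>"
      using car ab by (auto simp: u v_def swap_expectation_simps one_not_zero)
    moreover have "u \<in> carrier (swap_expectation E)"
      using car by (simp add: u swap_expectation_simps)
    ultimately show "u \<in> ?R"
      unfolding right_zero_divisors_def by blast
  qed
qed

end

lemma not_reversible_swap_expectation:
  assumes "nontrivial_semiring E"
  shows "\<not> reversible (swap_expectation E)"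
proof
  interpret nontrivial_semiring E by fact
  \<comment> \<open>With the idempotent \<open>e = (1, 0)\<close>, these are \<open>(e, 0)\<close>
    and \<open>(0, e)\<close>. Their products in the two orders are
    \<open>(0, \<sigma>(e) e) = 0\<close> and \<open>(0, e e) = (0, e)\<close>.\<close>
  let ?u = "((\<one>\<^bsub>E\<^esub>, \<zero>\<^bsub>E\<^esub>), (\<zero>\<^bsub>E\<^esub>, \<zero>\<^bsub>E\<^esub>))"
  let ?v = "((\<zero>\<^bsub>E\<^esub>, \<zero>\<^bsub>E\<^esub>), (\<one>\<^bsub>E\<^esub>, \<zero>\<^bsub>E\<^esub>))"
  assume rev: "reversible (swap_expectation E)"
  have "?u \<otimes>\<^bsub>swap_expectation E\<^esub> ?v = \<zero>\<^bsub>swap_expectation E\<^esub>"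
    "?u \<in> carrier (swap_expectation E)" "?v \<in> carrier (swap_expectation E)"
    by (simp_all add: swap_expectation_simps)
  with rev have "?v \<otimes>\<^bsub>swap_expectation E\<^esub> ?u = \<zero>\<^bsub>swap_expectation E\<^esub>"
    unfolding reversible_def by blast
  then show False
    by (simp add: swap_expectation_simps one_not_zero)
qed

theorem theorem4p10:
  fixes E :: "('a, 'm) ring_scheme"
    and S :: "('a \<times> 'a) ring"
    and \<sigma> :: "'a \<times> 'a \<Rightarrow> 'a \<times> 'a"
  assumes "commutative_semiring E" and "entire E"
    and "S = RDirProd E E"
    and "\<sigma> = (\<lambda>(s, t). (t, s))"
  shows "(nilpotent_free S \<and> \<sigma> \<in> semiring_end S) \<and>
         eversible (expectation_semiring S (self_semimodule S) \<sigma>) \<and>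
         (\<one>\<^bsub>E\<^esub> \<oplus>\<^bsub>E\<^esub> \<one>\<^bsub>E\<^esub> \<noteq> \<zero>\<^bsub>E\<^esub> \<longrightarrow>
           \<not> reversible (expectation_semiring S (self_semimodule S) \<sigma>))"
proof -
  interpret commutative_semiring E by fact
  have "eversible (swap_expectation E)"
    unfolding eversible_def
      left_zero_divisors_swap_expectation[OF nontrivial_semiring_axioms assms(2)]
      right_zero_divisors_swap_expectation[OF nontrivial_semiring_axioms assms(2)] ..
  moreover have "nilpotent_free (RDirProd E E)"
    using semiring_axioms assms(2) by (intro nilpotent_free_RDirProd)
  ultimately show ?thesis
    unfolding assms(3,4)
    using swap_semiring_end not_reversible_swap_expectation[OF nontrivial_semiring_axioms]
    by blast
qed

end
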